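(* Let $\widehat{X}$ be a sandpile graph whose sink has no outgoing edges, and let $e\in\mathcal{M}(\widehat{X})$ be an idempotent with $e\neq0$. Then $$G_e=\{g\oplus j:\ g,j\in\mathcal{M}(\widehat{X}),\ g\text{ is recurrent in the sandpile monoid of }\iota(\operatorname{supp}(e)),\ \operatorname{supp}(j)\subseteq A(e)\}.$$
   Context: A sandpile graph $\widehat{X}$ is a finite weakly connected directed multigraph (loops and multiple edges allowed) with a distinguished vertex, the sink, reachable by a directed path from every vertex; the set $V$ of non-sink vertices is nonempty, and $X$ is the digraph obtained by deleting the sink. A configuration assigns a nonnegative integer number of grains to each non-sink vertex; it is stable if every $v$ holds fewer than $\deg^{+}(v)$ (out-degree) grains. Toppling an unstable vertex sends one grain along each of its out-edges (grains at the sink vanish; the sink never topples); every configuration has a unique stabilization. $\mathcal{M}(\widehat X)$ is the set of stable configurations with $a\oplus b$ = stabilization of $a+b$ (commutative monoid, identity $0$). $a$ is accessible from $b$ if $b\oplus x=a$ for some $x$; $a$ is recurrent if accessible from every element. For an idempotent $e$, $G_e$ is the unique maximal subgroup of $\mathcal M(\widehat X)$ with identity $e$. $\operatorname{supp}(m)$ is the set of vertices holding at least one grain. A cycle is a directed closed path of length $\ge1$ in $X$. For $W\subseteq V$, $\operatorname{cl}(W)$ is the set of $z\in V$ reachable by a (possibly trivial) directed path in $X$ from some $w\in W$. For nonempty $S\subseteq V$, $\iota(S)$ is the subgraph of $\widehat X$ induced on $\operatorname{cl}(S)\cup\{\text{sink}\}$, with edges those of $\widehat X$ whose tail lies in this set;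 it is itself a sandpile graph, and its stable configurations are identified with configurations of $\widehat X$ vanishing outside $\operatorname{cl}(S)$. A strongly connected component is a maximal subset of $V$ whose vertices mutually reach each other by paths in $X$; it is cyclic if it contains a cycle. A vertex is acyclic if it lies on no cycle. $A(e)$ is the set of acyclic vertices $v\in V$ with $v\notin\operatorname{cl}(\operatorname{supp}(e))$ such that every cyclic strongly connected component reachable from $v$ by a path in $X$ intersects $\operatorname{supp}(e)$. *)

theory Defs
  imports "Graph_Theory.Digraph_Component" "HOL-Algebra.Group"
begin

locale sandpile_graph = fin_digraph G for G :: "('a, 'b) pre_digraph" and s :: 'a +
  assumes weakly_connected: "Digraph_Component.connected G"
    and sink_in_verts: "s \<in> verts G"
    and sink_reachable: "\<And>v. v \<in> verts G \<Longrightarrow> v \<rightarrow>\<^sup>*\<^bsub>G\<^esub> s"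
    and nonsink_nonempty: "verts G - {s} \<noteq> {}"

abbreviation nonsink :: "('a, 'b) pre_digraph \<Rightarrow> 'a \<Rightarrow> ('a, 'b) pre_digraph" where
  "nonsink G s \<equiv> pre_digraph.del_vert G s"

text \<open>
  Configurations are total functions that vanish off the non-sink vertices.  Hence
  configurations of a subgraph (with the same sink) are literally those configurations of
  the ambient graph that vanish outside the subgraph.
\<close>

definition configs :: "('a, 'b) pre_digraph \<Rightarrow> 'a \<Rightarrow> ('a \<Rightarrow> nat) set" where
  "configs G s = {c. \<forall>v. v \<notin> verts G - {s} \<longrightarrow> c v = 0}"

definition stable :: "('a, 'b) pre_digraph \<Rightarrow> 'a \<Rightarrow> ('a \<Rightarrow> nat) \<Rightarrow> bool" where
  "stable G s c \<longleftrightarrow> (\<forall>v \<in> verts G - {s}. c v < out_degree G v)"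

text \<open>
  Only used when \<open>v\<close> is unstable, so the subtraction on the naturals does not truncate.
  A loop at \<open>v\<close> contributes to the out-degree and returns its grain to \<open>v\<close>.
\<close>

definition topple :: "('a, 'b) pre_digraph \<Rightarrow> 'a \<Rightarrow> 'a \<Rightarrow> ('a \<Rightarrow> nat) \<Rightarrow> 'a \<Rightarrow> nat" where
  "topple G s v c = (\<lambda>w. if w = s then 0
     else (if w = v then c v - out_degree G v else c w) + card {a \<in> out_arcs G v. head G a = w})"

definition topples_to ::
  "('a, 'b) pre_digraph \<Rightarrow> 'a \<Rightarrow> ('a \<Rightarrow> nat) \<Rightarrow> ('a \<Rightarrow> nat) \<Rightarrow> bool" where
  "topples_to G s c c' \<longleftrightarrow>
     (\<exists>v \<in> verts G - {s}. out_degree G v \<le> c v \<and> c' = topple G s v c)"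

definition stabilization :: "('a, 'b) pre_digraph \<Rightarrow> 'a \<Rightarrow> ('a \<Rightarrow> nat) \<Rightarrow> 'a \<Rightarrow> nat" where
  "stabilization G s c = (THE c'. (topples_to G s)\<^sup>*\<^sup>* c c' \<and> stable G s c')"

definition sandpile_monoid :: "('a, 'b) pre_digraph \<Rightarrow> 'a \<Rightarrow> ('a \<Rightarrow> nat) monoid" where
  "sandpile_monoid G s =
     \<lparr> carrier = {c \<in> configs G s. stable G s c},
       mult = (\<lambda>a b. stabilization G s (\<lambda>v. a v + b v)),
       one = (\<lambda>_. 0) \<rparr>"

definition supp :: "('a \<Rightarrow> nat) \<Rightarrow> 'a set" where
  "supp c = {v. 1 \<le> c v}"

definition accessible :: "('c, 'd) monoid_scheme \<Rightarrow> 'c \<Rightarrow> 'c \<Rightarrow> bool" where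
  "accessible M a b \<longleftrightarrow> (\<exists>x \<in> carrier M. b \<otimes>\<^bsub>M\<^esub> x = a)"

definition recurrent :: "('c, 'd) monoid_scheme \<Rightarrow> 'c \<Rightarrow> bool" where
  "recurrent M a \<longleftrightarrow> a \<in> carrier M \<and> (\<forall>b \<in> carrier M. accessible M a b)"

text \<open>
  The identity \<open>e\<close> of the subgroup may differ from the identity of \<open>M\<close>, so the library's
  \<open>subgroup\<close> and \<open>submonoid\<close> do not apply.
\<close>

definition subgroup_at :: "('c, 'd) monoid_scheme \<Rightarrow> 'c \<Rightarrow> 'c set \<Rightarrow> bool" where
  "subgroup_at M e H \<longleftrightarrow> H \<subseteq> carrier M \<and> group (M\<lparr>carrier := H, one := e\<rparr>)"

definition maximal_subgroup :: "('c, 'd) monoid_scheme \<Rightarrow> 'c \<Rightarrow> 'c set" where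
  "maximal_subgroup M e =
     (THE H. subgroup_at M e H \<and> (\<forall>K. subgroup_at M e K \<and> H \<subseteq> K \<longrightarrow> K = H))"

definition cl :: "('a, 'b) pre_digraph \<Rightarrow> 'a \<Rightarrow> 'a set \<Rightarrow> 'a set" where
  "cl G s W = {z \<in> verts G - {s}. \<exists>w \<in> W. w \<rightarrow>\<^sup>*\<^bsub>nonsink G s\<^esub> z}"

definition iota :: "('a, 'b) pre_digraph \<Rightarrow> 'a \<Rightarrow> 'a set \<Rightarrow> ('a, 'b) pre_digraph" where
  "iota G s S =
     \<lparr> verts = cl G s S \<union> {s}, arcs = {a \<in> arcs G. tail G a \<in> cl G s S \<union> {s}},
       tail = tail G, head = head G \<rparr>"

definition cycle_on :: "('a, 'b) pre_digraph \<Rightarrow> 'a \<Rightarrow> 'a \<Rightarrow> 'b list \<Rightarrow> bool" where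
  "cycle_on G s u p \<longleftrightarrow> pre_digraph.awalk (nonsink G s) u p u \<and> 1 \<le> length p"

definition acyclic_vertex :: "('a, 'b) pre_digraph \<Rightarrow> 'a \<Rightarrow> 'a \<Rightarrow> bool" where
  "acyclic_vertex G s v \<longleftrightarrow>
     \<not> (\<exists>u p. cycle_on G s u p \<and> v \<in> set (pre_digraph.awalk_verts (nonsink G s) u p))"

definition cyclic_component :: "('a, 'b) pre_digraph \<Rightarrow> 'a \<Rightarrow> 'a set \<Rightarrow> bool" where
  "cyclic_component G s C \<longleftrightarrow> C \<in> pre_digraph.sccs_verts (nonsink G s) \<and>
     (\<exists>u p. cycle_on G s u p \<and> set (pre_digraph.awalk_verts (nonsink G s) u p) \<subseteq> C)"

definition A_set :: "('a, 'b) pre_digraph \<Rightarrow> 'a \<Rightarrow> ('a \<Rightarrow> nat) \<Rightarrow> 'a set" where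
  "A_set G s e = {v \<in> verts G - {s}. acyclic_vertex G s v \<and> v \<notin> cl G s (supp e) \<and>
     (\<forall>C. cyclic_component G s C \<and> (\<exists>w \<in> C. v \<rightarrow>\<^sup>*\<^bsub>nonsink G s\<^esub> w) \<longrightarrow> C \<inter> supp e \<noteq> {})}"

end

theory Submission
  imports Defs
begin

text \<open>
  The group \<open>G\<^sub>e\<close> consists of the stable \<open>a\<close> with \<open>a \<oplus> e = a\<close> that divide \<open>e\<close>, i.e.
  \<open>a \<oplus> b = e\<close> for some \<open>b\<close>.  Since \<open>e\<close> is idempotent, sums of divisors of \<open>e\<close> are divisors,
  so a configuration divides \<open>e\<close> iff each vertex of its support does (as a single grain).
  Toppling shows that a vertex divides \<open>e\<close> iff all its non-sink out-neighbours do.  Hence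
  \<open>cl (supp e)\<close> consists of divisors, and so does \<open>A(e)\<close>, which is acyclic with all arcs leading
  into \<open>A(e) \<union> cl (supp e) \<union> {s}\<close>.  Conversely, a grain in a cyclic strongly connected component
  can never leave that component completely, so a divisor of \<open>e\<close> only reaches cyclic components
  that meet \<open>supp e\<close>.  Thus the divisors are exactly the configurations supported on
  \<open>cl (supp e) \<union> A(e)\<close>; restricting \<open>a \<in> G\<^sub>e\<close> to the two parts yields \<open>g\<close> and \<open>j\<close>.
\<close>

section \<open>Maximal subgroups of commutative monoids\<close>

text \<open>The set on the right is a group with identity \<open>e\<close> and contains every other
  such group, so it is the greatest one and the \<open>THE\<close> in
  \<open>maximal_subgroup\<close> is well defined.\<close>

lemma maximal_subgroup_eq:
  assumes "comm_monoid M" and e: "e \<in> carrier M" "e \<otimes>\<^bsub>M\<^esub> e = e"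
  shows "maximal_subgroup M e =
    {a \<in> carrier M. a \<otimes>\<^bsub>M\<^esub> e = a \<and> (\<exists>b \<in> carrier M. a \<otimes>\<^bsub>M\<^esub> b = e)}" (is "_ = ?H")
proof -
  interpret comm_monoid M by fact
  have sub: "K \<subseteq> ?H" if "subgroup_at M e K" for K
  proof
    fix a assume a: "a \<in> K"
    interpret K: group "M\<lparr>carrier := K, one := e\<rparr>" using that by (simp add: subgroup_at_def)
    from that have "K \<subseteq> carrier M" by (simp add: subgroup_at_def)
    moreover have "a \<otimes>\<^bsub>M\<^esub> e = a" using K.r_one a by simp
    moreover obtain b where "b \<in> K" "a \<otimes>\<^bsub>M\<^esub> b = e"
      using K.r_inv_ex a by auto
    ultimately show "a \<in> ?H" using a by auto
  qed
  have "group (M\<lparr>carrier := ?H, one := e\<rparr>)"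
  proof (rule groupI)
    fix x y assume "x \<in> carrier (M\<lparr>carrier := ?H, one := e\<rparr>)"
      "y \<in> carrier (M\<lparr>carrier := ?H, one := e\<rparr>)"
    then obtain b c where xy: "x \<in> carrier M" "y \<in> carrier M" "x \<otimes>\<^bsub>M\<^esub> e = x" "y \<otimes>\<^bsub>M\<^esub> e = y"
      and bc: "b \<in> carrier M" "c \<in> carrier M" "x \<otimes>\<^bsub>M\<^esub> b = e" "y \<otimes>\<^bsub>M\<^esub> c = e" by auto
    have "(x \<otimes>\<^bsub>M\<^esub> y) \<otimes>\<^bsub>M\<^esub> (b \<otimes>\<^bsub>M\<^esub> c) = (x \<otimes>\<^bsub>M\<^esub> b) \<otimes>\<^bsub>M\<^esub> (y \<otimes>\<^bsub>M\<^esub> c)"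
      using xy bc(1,2) by (simp add: m_ac)
    then have "(x \<otimes>\<^bsub>M\<^esub> y) \<otimes>\<^bsub>M\<^esub> (b \<otimes>\<^bsub>M\<^esub> c) = e" using bc e by simp
    moreover have "(x \<otimes>\<^bsub>M\<^esub> y) \<otimes>\<^bsub>M\<^esub> e = x \<otimes>\<^bsub>M\<^esub> y" using xy e by (simp add: m_assoc)
    ultimately show "x \<otimes>\<^bsub>M\<lparr>carrier := ?H, one := e\<rparr>\<^esub> y \<in> carrier (M\<lparr>carrier := ?H, one := e\<rparr>)"
      using xy bc by auto
  next
    fix x assume "x \<in> carrier (M\<lparr>carrier := ?H, one := e\<rparr>)"
    then obtain b where x: "x \<in> carrier M" "x \<otimes>\<^bsub>M\<^esub> e = x"
      and b: "b \<in> carrier M" "x \<otimes>\<^bsub>M\<^esub> b = e" by auto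
    \<comment> \<open>The cofactor \<open>b\<close> need not be fixed by multiplication with
      \<open>e\<close>; \<open>b \<otimes> e\<close> is, and it serves as the inverse of
      \<open>x\<close> inside \<open>?H\<close>.\<close>
    have "(b \<otimes>\<^bsub>M\<^esub> e) \<otimes>\<^bsub>M\<^esub> x = e"
      using x b e by (metis m_assoc m_comm)
    moreover have "b \<otimes>\<^bsub>M\<^esub> e \<in> ?H"
      using x b e calculation by (auto simp: m_assoc)
    ultimately show "\<exists>y\<in>carrier (M\<lparr>carrier := ?H, one := e\<rparr>).
        y \<otimes>\<^bsub>M\<lparr>carrier := ?H, one := e\<rparr>\<^esub> x = \<one>\<^bsub>M\<lparr>carrier := ?H, one := e\<rparr>\<^esub>" by auto
    show "\<one>\<^bsub>M\<lparr>carrier := ?H, one := e\<rparr>\<^esub> \<otimes>\<^bsub>M\<lparr>carrier := ?H, one := e\<rparr>\<^esub> x = x"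
      using x e by (simp add: m_comm)
  qed (use e in \<open>auto simp: m_assoc\<close>)
  then have "subgroup_at M e ?H" by (auto simp: subgroup_at_def)
  then show ?thesis
    unfolding maximal_subgroup_def using sub by (intro the_equality) blast+
qed

lemma supp_add: "supp (\<lambda>v. c v + d v) = supp c \<union> supp d"
  by (auto simp: supp_def)

definition grain :: "'a \<Rightarrow> 'a \<Rightarrow> nat" where
  "grain v = (\<lambda>w. if w = v then 1 else 0)"

lemma supp_grain [simp]: "supp (grain v) = {v}"
  by (auto simp: supp_def grain_def)

context sandpile_graph
begin

abbreviation V :: "'a set" where "V \<equiv> verts G - {s}"

abbreviation X :: "('a, 'b) pre_digraph" where "X \<equiv> nonsink G s"

abbreviation stab :: "('a \<Rightarrow> nat) \<Rightarrow> 'a \<Rightarrow> nat" where "stab \<equiv> stabilization G s"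

sublocale X: fin_digraph X
  by (rule fin_digraph_del_vert)

lemma configs_iff_supp: "c \<in> configs G s \<longleftrightarrow> supp c \<subseteq> V"
  by (auto simp: configs_def supp_def Suc_le_eq)

subsection \<open>Stabilization\<close>

text \<open>
  Let \<open>d v\<close> be the distance from \<open>v\<close> to the sink.  With \<open>B\<close> larger than all out-degrees and
  \<open>N\<close> at least all distances, \<open>B ^ (N - d v)\<close> is strictly smaller than the average of this
  quantity over the heads of the arcs leaving \<open>v\<close>, because one head is closer to the sink.
\<close>

lemma strictly_superharmonic_weight:
  "\<exists>h :: 'a \<Rightarrow> nat. h s = 0 \<and>
    (\<forall>v\<in>V. (\<Sum>a\<in>out_arcs G v. h (head G a)) < out_degree G v * h v)"
proof -
  define d where "d v = (LEAST n. (v, s) \<in> arcs_ends G ^^ n)" for v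
  define N where "N = Max (d ` verts G)"
  define B where "B = Suc (card (arcs G))"
  define k where "k v = B ^ (N - d v)" for v
  have dN: "d v \<le> N" if "v \<in> verts G" for v
    using that by (auto simp: N_def)
  have ds: "d s = 0" by (simp add: d_def Least_eq_0)
  have ks: "k v \<le> k s" for v
    unfolding k_def ds by (intro power_increasing) (auto simp: B_def)
  have gt: "out_degree G v * k v < (\<Sum>a\<in>out_arcs G v. k (head G a))" if v: "v \<in> V" for v
  proof -
    have "\<exists>n. (v, s) \<in> arcs_ends G ^^ n"
      using sink_reachable[of v] v by (auto simp: reachable_conv intro: rtrancl_imp_relpow)
    then have dv: "(v, s) \<in> arcs_ends G ^^ d v"
      unfolding d_def by (rule LeastI_ex)
    with v obtain m where m: "d v = Suc m" by (cases "d v") auto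
    with dv obtain u where u: "(v, u) \<in> arcs_ends G" "(u, s) \<in> arcs_ends G ^^ m"
      using relpow_Suc_D2 by metis
    then obtain a where a: "a \<in> out_arcs G v" "head G a = u"
      by (auto simp: arcs_ends_def arc_to_ends_def)
    have "d u \<le> m" unfolding d_def using u(2) by (rule Least_le)
    \<comment> \<open>The single head \<open>u\<close> closer to the sink already outweighs the
      whole left side: \<open>k u\<close> is at least \<open>B * k v\<close>.\<close>
    have "out_degree G v < B"
      unfolding out_degree_def B_def by (auto simp: less_Suc_eq_le intro!: card_mono)
    then have "out_degree G v * k v < B * k v"
      by (intro mult_strict_right_mono) (simp_all add: k_def B_def)
    also have "\<dots> = B ^ (N - m)"
      using dN[of v] v m by (simp add: k_def flip: power_Suc) (metis Suc_diff_Suc Suc_le_eq power_Suc)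
    also have "\<dots> \<le> k u"
      unfolding k_def using \<open>d u \<le> m\<close> by (intro power_increasing) (auto simp: B_def)
    also have "\<dots> \<le> (\<Sum>a\<in>out_arcs G v. k (head G a))"
      using a by (metis member_le_sum finite_out_arcs le0)
    finally show ?thesis .
  qed
  show ?thesis
  \<comment> \<open>\<open>k\<close> is maximal at the sink and strictly below its neighbour average
    elsewhere; subtracting it from \<open>k s\<close> reverses the inequality and gives the value 0
    at the sink.\<close>
  proof (intro exI[of _ "\<lambda>v. k s - k v"] conjI ballI)
    fix v assume v: "v \<in> V"
    have "int (\<Sum>a\<in>out_arcs G v. k s - k (head G a)) =
        int (out_degree G v * k s) - int (\<Sum>a\<in>out_arcs G v. k (head G a))"
      using ks by (simp add: of_nat_diff sum_subtractf out_degree_def)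
    also have "\<dots> < int (out_degree G v * k s) - int (out_degree G v * k v)"
      using gt[OF v] by linarith
    also have "\<dots> = int (out_degree G v * (k s - k v))"
      using ks by (simp add: of_nat_diff right_diff_distrib)
    finally show "(\<Sum>a\<in>out_arcs G v. k s - k (head G a)) < out_degree G v * (k s - k v)"
      by linarith
  qed simp
qed

text \<open>The strict inequality above would read \<open>_ < 0\<close> at a vertex of out-degree 0.
  Consequently the zero configuration is stable and only a vertex holding a grain can
  topple.\<close>

lemma out_degree_pos: "v \<in> V \<Longrightarrow> 0 < out_degree G v"
  using strictly_superharmonic_weight by (metis gr0I mult_0 not_less_zero)

text \<open>Give a grain at \<open>w\<close> the weight \<open>h w\<close>. Toppling
  \<open>v\<close> removes \<open>out_degree G v\<close> grains of weight \<open>h v\<close> and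
  adds grains whose total weight is strictly smaller, so the total weight is a termination
  measure.\<close>

lemma wfP_topples_to: "wfP (\<lambda>c' c. topples_to G s c c')"
proof -
  obtain h :: "'a \<Rightarrow> nat" where hs: "h s = 0"
    and h: "\<And>v. v \<in> V \<Longrightarrow> (\<Sum>a\<in>out_arcs G v. h (head G a)) < out_degree G v * h v"
    using strictly_superharmonic_weight by blast
  define weight where "weight c = (\<Sum>w\<in>V. c w * h w)" for c :: "'a \<Rightarrow> nat"
  have "weight c' < weight c" if "topples_to G s c c'" for c c'
  proof -
    from that obtain v where v: "v \<in> V" "out_degree G v \<le> c v" "c' = topple G s v c"
      by (auto simp: topples_to_def)
    \<comment> \<open>The arcs are grouped by head to match the grain counts in
      \<open>topple\<close>; grains lost in the sink do not matter because
      \<open>h s = 0\<close>.\<close>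
    have "(\<Sum>a\<in>out_arcs G v. h (head G a)) =
        (\<Sum>w\<in>verts G. \<Sum>a\<in>{a \<in> out_arcs G v. head G a = w}. h (head G a))"
      by (intro sum.group[symmetric]) auto
    also have "\<dots> = (\<Sum>w\<in>verts G. card {a \<in> out_arcs G v. head G a = w} * h w)"
      by (intro sum.cong) auto
    also have "\<dots> = (\<Sum>w\<in>V. card {a \<in> out_arcs G v. head G a = w} * h w)"
      using hs by (intro sum.mono_neutral_right) auto
    finally have 1: "(\<Sum>w\<in>V. card {a \<in> out_arcs G v. head G a = w} * h w) < out_degree G v * h v"
      using h[OF v(1)] by simp
    have "weight c' = (\<Sum>w\<in>V. (if w = v then c v - out_degree G v else c w) * h w
        + card {a \<in> out_arcs G v. head G a = w} * h w)"
      unfolding weight_def v(3) by (intro sum.cong) (auto simp: topple_def algebra_simps)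
    also have "\<dots> < (\<Sum>w\<in>V. (if w = v then c v - out_degree G v else c w) * h w) + out_degree G v * h v"
      using 1 by (simp add: sum.distrib)
    also have "\<dots> = (c v - out_degree G v) * h v + out_degree G v * h v + (\<Sum>w\<in>V-{v}. c w * h w)"
      using v(1) by (subst sum.remove[of V v]) auto
    also have "\<dots> = c v * h v + (\<Sum>w\<in>V-{v}. c w * h w)"
      using v(2) by (simp flip: add_mult_distrib)
    also have "\<dots> = weight c"
      unfolding weight_def using v(1) by (subst sum.remove[of V v]) auto
    finally show ?thesis .
  qed
  then show ?thesis
    by (intro wfp_if_convertible_to_nat[of _ weight])
qed

text \<open>Topplings at distinct vertices commute: each can only add grains at the other vertex,
  which therefore stays unstable.\<close>

lemma topples_to_diamond:
  assumes "topples_to G s c c1" "topples_to G s c c2"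
  shows "c1 = c2 \<or> (\<exists>c'. topples_to G s c1 c' \<and> topples_to G s c2 c')"
proof -
  obtain u v where u: "u \<in> V" "out_degree G u \<le> c u" "c1 = topple G s u c"
    and v: "v \<in> V" "out_degree G v \<le> c v" "c2 = topple G s v c"
    using assms by (auto simp: topples_to_def)
  show ?thesis
  proof (cases "u = v")
    case True
    then show ?thesis using u v by simp
  next
    case False
    have "topple G s v c1 = topple G s u c2"
      using u v False by (auto simp: topple_def fun_eq_iff)
    moreover have "out_degree G v \<le> c1 v" "out_degree G u \<le> c2 u"
      using u v False by (simp_all add: topple_def)
    ultimately show ?thesis using u(1) v(1) unfolding topples_to_def by metis
  qed
qed

lemma stable_iff: "stable G s c \<longleftrightarrow> (\<nexists>c'. topples_to G s c c')"
  by (meson stable_def topples_to_def not_less)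

lemma ex_stable: "\<exists>c'. (topples_to G s)\<^sup>*\<^sup>* c c' \<and> stable G s c'"
proof (induction c rule: wfp_induct_rule[OF wfP_topples_to])
  case (1 c)
  then show ?case
    by (metis converse_rtranclp_into_rtranclp rtranclp.rtrancl_refl stable_iff)
qed

text \<open>Newman's argument: well-founded induction on toppling, with the diamond property closing
  two different first steps.\<close>

lemma stable_unique:
  assumes "(topples_to G s)\<^sup>*\<^sup>* c c1" "stable G s c1" "(topples_to G s)\<^sup>*\<^sup>* c c2" "stable G s c2"
  shows "c1 = c2"
  using assms
proof (induction c arbitrary: c1 c2 rule: wfp_induct_rule[OF wfP_topples_to])
  case (1 c)
  show ?case
  proof (cases "stable G s c")
    case True
    then show ?thesis using 1(2,4) by (metis converse_rtranclpE stable_iff)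
  next
    case False
    then obtain d1 d2 where d1: "topples_to G s c d1" "(topples_to G s)\<^sup>*\<^sup>* d1 c1"
      and d2: "topples_to G s c d2" "(topples_to G s)\<^sup>*\<^sup>* d2 c2"
      using 1(2-5) by (metis converse_rtranclpE)
    show ?thesis
    proof (cases "d1 = d2")
      case True
      then show ?thesis using 1 d1 d2 by blast
    next
      case False
      then obtain d where d: "topples_to G s d1 d" "topples_to G s d2 d"
        using topples_to_diamond d1 d2 by blast
      \<comment> \<open>By the induction hypotheses for \<open>d1\<close> and \<open>d2\<close>,
        both \<open>c1\<close> and \<open>c2\<close> equal the stable configuration
        \<open>c3\<close> reached through the common successor \<open>d\<close>.\<close>
      obtain c3 where "(topples_to G s)\<^sup>*\<^sup>* d c3" "stable G s c3" using ex_stable by blast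
      with d 1 d1 d2 show ?thesis by (metis converse_rtranclp_into_rtranclp)
    qed
  qed
qed

lemma stab_eqI: "(topples_to G s)\<^sup>*\<^sup>* c c' \<Longrightarrow> stable G s c' \<Longrightarrow> stab c = c'"
  unfolding stabilization_def using stable_unique by blast

lemma topples_to_stab: "(topples_to G s)\<^sup>*\<^sup>* c (stab c)"
  and stable_stab: "stable G s (stab c)"
  using ex_stable[of c] stab_eqI by auto

lemma stab_stable: "stable G s c \<Longrightarrow> stab c = c"
  by (simp add: stab_eqI)

lemma stab_topples_to: "(topples_to G s)\<^sup>*\<^sup>* c c' \<Longrightarrow> stab c = stab c'"
  by (meson stab_eqI rtranclp_trans topples_to_stab stable_stab)

text \<open>Extra grains keep every toppling legal. They must avoid the sink, since
  \<open>topple\<close> resets the sink to 0.\<close>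

lemma topples_to_add:
  assumes "(topples_to G s)\<^sup>*\<^sup>* c c'" "supp x \<subseteq> V"
  shows "(topples_to G s)\<^sup>*\<^sup>* (\<lambda>v. c v + x v) (\<lambda>v. c' v + x v)"
  using assms(1)
proof induction
  case (step y z)
  have "x s = 0" using assms(2) by (auto simp: supp_def Suc_le_eq)
  obtain u where u: "u \<in> V" "out_degree G u \<le> y u" "z = topple G s u y"
    using step(2) by (auto simp: topples_to_def)
  then have "(\<lambda>v. z v + x v) = topple G s u (\<lambda>v. y v + x v)"
    using \<open>x s = 0\<close> by (auto simp: topple_def fun_eq_iff)
  then have "topples_to G s (\<lambda>v. y v + x v) (\<lambda>v. z v + x v)"
    unfolding topples_to_def using u trans_le_add1 by blast
  with step(3) show ?case by simp
qed simp

text \<open>By uniqueness of stabilization an inner \<open>stab\<close> may be dropped;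
  associativity and all later computations in the monoid rest on this.\<close>

lemma stab_add_left: "supp x \<subseteq> V \<Longrightarrow> stab (\<lambda>v. stab c v + x v) = stab (\<lambda>v. c v + x v)"
  by (rule stab_topples_to[OF topples_to_add[OF topples_to_stab], symmetric])

lemma stab_add_right: "supp x \<subseteq> V \<Longrightarrow> stab (\<lambda>v. x v + stab c v) = stab (\<lambda>v. x v + c v)"
  using stab_add_left[of x c] by (simp add: add.commute)

section \<open>Sets of vertices closed under out-arcs\<close>

text \<open>The two instances used are \<open>V\<close>, for the whole monoid, and
  \<open>cl G s S\<close>, for the monoid of \<open>iota G s S\<close>; the theory of divisors is
  thereby developed once for both.\<close>

definition out_closed :: "'a set \<Rightarrow> bool" where
  "out_closed T \<longleftrightarrow> T \<subseteq> V \<and> (\<forall>a \<in> arcs G. tail G a \<in> T \<longrightarrow> head G a \<in> T \<union> {s})"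

lemma out_closed_V: "out_closed V"
  by (auto simp: out_closed_def)

text \<open>A vertex that topples holds a grain and so lies in \<open>T\<close>; any vertex that is
  new in the support is the head of one of its arcs.\<close>

lemma supp_topple:
  assumes "topples_to G s c c'" "out_closed T" "supp c \<subseteq> T"
  shows "supp c' \<subseteq> T"
proof
  fix w assume w: "w \<in> supp c'"
  from assms(1) obtain v where v: "v \<in> V" "out_degree G v \<le> c v" "c' = topple G s v c"
    by (auto simp: topples_to_def)
  then have "v \<in> T" using out_degree_pos[of v] assms(3) by (auto simp: supp_def)
  have "w \<noteq> s" using w v by (auto simp: supp_def topple_def)
  show "w \<in> T"
  proof (cases "\<exists>a\<in>out_arcs G v. head G a = w")
    case True
    then show ?thesis using \<open>v \<in> T\<close> assms(2) \<open>w \<noteq> s\<close> by (auto simp: out_closed_def)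
  next
    case False
    then have "{a \<in> out_arcs G v. head G a = w} = {}" by auto
    then have "card {a \<in> out_arcs G v. head G a = w} = 0" by (simp only: card.empty)
    then have "c' w \<le> c w" using v \<open>w \<noteq> s\<close> by (simp add: topple_def del: in_out_arcs_conv)
    then have "w \<in> supp c" using w by (auto simp: supp_def)
    then show ?thesis using assms(3) by auto
  qed
qed

lemma supp_stab:
  assumes "out_closed T" "supp c \<subseteq> T"
  shows "supp (stab c) \<subseteq> T"
  using topples_to_stab[of c]
  by induction (use assms supp_topple in blast)+

section \<open>The sandpile monoid\<close>

lemma in_carrier: "c \<in> carrier (sandpile_monoid G s) \<longleftrightarrow> supp c \<subseteq> V \<and> stable G s c"
  by (simp add: sandpile_monoid_def configs_iff_supp)

lemma mult_eq: "a \<otimes>\<^bsub>sandpile_monoid G s\<^esub> b = stab (\<lambda>v. a v + b v)"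
  by (simp add: sandpile_monoid_def)

lemma stab_in_carrier: "supp c \<subseteq> V \<Longrightarrow> stab c \<in> carrier (sandpile_monoid G s)"
  by (simp add: in_carrier supp_stab out_closed_V stable_stab)

lemma comm_monoid_sandpile: "comm_monoid (sandpile_monoid G s)"
proof (rule comm_monoidI)
  show "\<one>\<^bsub>sandpile_monoid G s\<^esub> \<in> carrier (sandpile_monoid G s)"
    using out_degree_pos by (simp add: sandpile_monoid_def configs_def stable_def)
next
  fix x y z assume "x \<in> carrier (sandpile_monoid G s)" "y \<in> carrier (sandpile_monoid G s)"
    "z \<in> carrier (sandpile_monoid G s)"
  then show "x \<otimes>\<^bsub>sandpile_monoid G s\<^esub> y \<otimes>\<^bsub>sandpile_monoid G s\<^esub> z =
      x \<otimes>\<^bsub>sandpile_monoid G s\<^esub> (y \<otimes>\<^bsub>sandpile_monoid G s\<^esub> z)"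
    by (simp add: in_carrier mult_eq stab_add_left stab_add_right add.assoc)
next
  fix x assume "x \<in> carrier (sandpile_monoid G s)"
  then show "\<one>\<^bsub>sandpile_monoid G s\<^esub> \<otimes>\<^bsub>sandpile_monoid G s\<^esub> x = x"
    by (simp add: sandpile_monoid_def stab_stable)
qed (auto simp: mult_eq add.commute intro!: stab_in_carrier, auto simp: in_carrier supp_add)

subsection \<open>Divisors of an idempotent\<close>

text \<open>Neither \<open>c\<close> nor the cofactor has to be stable, so divisors can be added and
  toppled freely; \<open>maximal_subgroup_iff_supp\<close> returns to stable cofactors.\<close>

definition divisor_on :: "'a set \<Rightarrow> ('a \<Rightarrow> nat) \<Rightarrow> ('a \<Rightarrow> nat) \<Rightarrow> bool" where
  "divisor_on T e c \<longleftrightarrow> supp c \<subseteq> T \<and> (\<exists>y. supp y \<subseteq> T \<and> stab (\<lambda>v. c v + y v) = e)"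

text \<open>Write \<open>e\<close> as \<open>e \<oplus> e\<close>, replace the two copies by
  \<open>c + y\<close> and \<open>d + z\<close>, and regroup: the cofactor of the sum is
  \<open>y + z\<close>.\<close>

lemma divisor_on_add:
  assumes T: "out_closed T" and e: "stab (\<lambda>v. e v + e v) = e"
    and "divisor_on T e c" "divisor_on T e d"
  shows "divisor_on T e (\<lambda>v. c v + d v)"
proof -
  obtain y z where yz: "supp y \<subseteq> T" "supp z \<subseteq> T"
    and "stab (\<lambda>v. c v + y v) = e" "stab (\<lambda>v. d v + z v) = e"
    and cd: "supp c \<subseteq> T" "supp d \<subseteq> T"
    using assms(3,4) by (auto simp: divisor_on_def)
  then have "e = stab (\<lambda>v. stab (\<lambda>v. c v + y v) v + stab (\<lambda>v. d v + z v) v)"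
    using e by simp
  also have "\<dots> = stab (\<lambda>v. (c v + y v) + stab (\<lambda>v. d v + z v) v)"
    using T yz cd by (intro stab_add_left supp_stab out_closed_V) (auto simp: supp_add out_closed_def)
  also have "\<dots> = stab (\<lambda>v. (c v + y v) + (d v + z v))"
    using T yz cd by (intro stab_add_right) (auto simp: supp_add out_closed_def)
  also have "\<dots> = stab (\<lambda>v. (c v + d v) + (y v + z v))"
    by (simp add: algebra_simps)
  finally show ?thesis
    using yz cd unfolding divisor_on_def
    by (intro conjI exI[of _ "\<lambda>v. y v + z v"]) (auto simp: supp_add)
qed

text \<open>The missing grains \<open>d - c\<close> are moved into the cofactor.\<close>

lemma divisor_on_mono:
  assumes "divisor_on T e d" "\<And>v. c v \<le> d v"
  shows "divisor_on T e c"
proof -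
  obtain y where y: "supp y \<subseteq> T" "stab (\<lambda>v. d v + y v) = e" and d: "supp d \<subseteq> T"
    using assms(1) by (auto simp: divisor_on_def)
  have "(\<lambda>v. c v + ((d v - c v) + y v)) = (\<lambda>v. d v + y v)"
  proof
    fix v show "c v + ((d v - c v) + y v) = d v + y v" using assms(2)[of v] by simp
  qed
  moreover have "supp (\<lambda>v. (d v - c v) + y v) \<subseteq> T"
  proof
    fix v assume "v \<in> supp (\<lambda>v. (d v - c v) + y v)"
    then have "v \<in> supp d \<or> v \<in> supp y" by (auto simp: supp_def)
    then show "v \<in> T" using y(1) d by auto
  qed
  moreover have "supp c \<subseteq> T" using d assms(2) by (fastforce simp: supp_def intro: order_trans)
  ultimately show ?thesis
    unfolding divisor_on_def using y by (intro conjI exI[of _ "\<lambda>v. (d v - c v) + y v"]) simp_all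
qed

lemma divisor_on_self: "stab (\<lambda>v. e v + e v) = e \<Longrightarrow> supp e \<subseteq> T \<Longrightarrow> divisor_on T e e"
  by (auto simp: divisor_on_def)

lemma divisor_on_zero: "stab (\<lambda>v. e v + e v) = e \<Longrightarrow> supp e \<subseteq> T \<Longrightarrow> divisor_on T e (\<lambda>_. 0)"
  by (rule divisor_on_mono[OF divisor_on_self]) auto

lemma divisor_on_stab:
  assumes "out_closed T" "divisor_on T e c"
  shows "divisor_on T e (stab c)"
proof -
  obtain y where "supp y \<subseteq> T" "stab (\<lambda>v. c v + y v) = e" "supp c \<subseteq> T"
    using assms(2) by (auto simp: divisor_on_def)
  moreover from this have "stab (\<lambda>v. stab c v + y v) = e"
    using stab_add_left[of y c] assms(1) by (auto simp: out_closed_def)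
  ultimately show ?thesis
    unfolding divisor_on_def using supp_stab[OF assms(1)] by blast
qed

text \<open>Divisors are closed downwards and under sums, and \<open>c\<close> is a finite sum of
  grains on its support. Being a divisor thus depends on the support alone.\<close>

lemma divisor_on_iff_grains:
  assumes T: "out_closed T" and e: "stab (\<lambda>v. e v + e v) = e" "supp e \<subseteq> T"
  shows "divisor_on T e c \<longleftrightarrow> (\<forall>v\<in>supp c. divisor_on T e (grain v))"
proof
  assume "divisor_on T e c"
  then show "\<forall>v\<in>supp c. divisor_on T e (grain v)"
    by (auto intro: divisor_on_mono simp: supp_def grain_def)
next
  assume c: "\<forall>v\<in>supp c. divisor_on T e (grain v)"
  have mult: "divisor_on T e (\<lambda>w. n * grain v w)" if "v \<in> supp c" for v n
  proof (induction n)
    case 0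
    then show ?case using divisor_on_zero[OF e] by simp
  next
    case (Suc n)
    then show ?case using divisor_on_add[OF T e(1) bspec[OF c that], of "\<lambda>w. n * grain v w"] by simp
  qed
  have sub: "supp c \<subseteq> V" using c T by (auto simp: divisor_on_def out_closed_def)
  have sum: "divisor_on T e (\<lambda>w. \<Sum>v\<in>F. c v * grain v w)" if "finite F" "F \<subseteq> supp c" for F
    using that
  proof induction
    case empty
    then show ?case using divisor_on_zero[OF e] by simp
  next
    case (insert v F)
    then have "divisor_on T e (\<lambda>w. c v * grain v w + (\<Sum>v\<in>F. c v * grain v w))"
      by (intro divisor_on_add[OF T e(1)] mult) auto
    then show ?case using insert.hyps by simp
  qed
  have fin: "finite (supp c)" using finite_subset[OF sub] by simp
  have "(\<lambda>w. \<Sum>v\<in>supp c. c v * grain v w) = c"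
  proof
    fix w
    have "(\<Sum>v\<in>supp c. c v * grain v w) = (\<Sum>v\<in>supp c. if w = v then c v else 0)"
      by (intro sum.cong) (auto simp: grain_def)
    also have "\<dots> = (if w \<in> supp c then c w else 0)" using fin by simp
    also have "\<dots> = c w" by (simp add: supp_def)
    finally show "(\<Sum>v\<in>supp c. c v * grain v w) = c w" .
  qed
  with sum[OF fin order_refl] show "divisor_on T e c" by (simp only:)
qed

section \<open>Divisors along arcs\<close>

text \<open>This is what remains after toppling a pile of exactly \<open>out_degree G v\<close>
  grains at \<open>v\<close>.\<close>

definition spread :: "'a \<Rightarrow> 'a \<Rightarrow> nat" where
  "spread v = (\<lambda>w. if w = s then 0 else card {a \<in> out_arcs G v. head G a = w})"

lemma supp_spread: "supp (spread v) = {head G a | a. a \<in> out_arcs G v \<and> head G a \<noteq> s}"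
proof -
  have "0 < card {a \<in> out_arcs G v. head G a = w} \<longleftrightarrow> (\<exists>a\<in>out_arcs G v. head G a = w)" for w
    by (auto simp: card_gt_0_iff)
  then show ?thesis by (auto simp: supp_def spread_def Suc_le_eq simp del: in_out_arcs_conv)
qed

lemma topples_to_spread: "v \<in> V \<Longrightarrow> topples_to G s (\<lambda>w. out_degree G v * grain v w) (spread v)"
  by (auto simp: topples_to_def topple_def spread_def grain_def fun_eq_iff intro!: bexI[of _ v])

lemma stab_spread_add:
  assumes "v \<in> V" "supp y \<subseteq> V"
  shows "stab (\<lambda>w. out_degree G v * grain v w + y w) = stab (\<lambda>w. spread v w + y w)"
proof -
  have "(topples_to G s)\<^sup>*\<^sup>* (\<lambda>w. out_degree G v * grain v w) (spread v)"
    using topples_to_spread[OF assms(1)] by blast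
  then show ?thesis by (rule stab_topples_to[OF topples_to_add]) fact
qed

text \<open>A full pile at \<open>v\<close> has the same support as one grain, so it divides
  \<open>e\<close> exactly when the grain does. Toppling turns the pile into
  \<open>spread v\<close>, whose support is the set of non-sink heads.\<close>

lemma divisor_on_grain_iff_spread:
  assumes T: "out_closed T" and e: "stab (\<lambda>v. e v + e v) = e" "supp e \<subseteq> T" and v: "v \<in> T"
  shows "divisor_on T e (grain v) \<longleftrightarrow>
    (\<forall>a\<in>out_arcs G v. head G a \<noteq> s \<longrightarrow> divisor_on T e (grain (head G a)))"
proof -
  have vV: "v \<in> V" using T v by (auto simp: out_closed_def)
  have "supp (\<lambda>w. out_degree G v * grain v w) = {v}"
    using out_degree_pos[OF vV] by (auto simp: supp_def grain_def)
  then have "divisor_on T e (grain v) \<longleftrightarrow> divisor_on T e (\<lambda>w. out_degree G v * grain v w)"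
    using divisor_on_iff_grains[OF T e, of "\<lambda>w. out_degree G v * grain v w"] by simp
  also have "\<dots> \<longleftrightarrow> divisor_on T e (spread v)"
  proof -
    have "supp (spread v) \<subseteq> T"
      using T v by (auto simp: supp_spread out_closed_def)
    moreover have "supp y \<subseteq> V" if "supp y \<subseteq> T" for y using that T by (auto simp: out_closed_def)
    ultimately show ?thesis
      unfolding divisor_on_def \<open>supp (\<lambda>w. out_degree G v * grain v w) = {v}\<close>
      using v stab_spread_add[OF vV] by auto
  qed
  also have "\<dots> \<longleftrightarrow> (\<forall>a\<in>out_arcs G v. head G a \<noteq> s \<longrightarrow> divisor_on T e (grain (head G a)))"
    unfolding divisor_on_iff_grains[OF T e, of "spread v"] supp_spread by blast
  finally show ?thesis .
qed

lemma arc_in_X: "a \<in> arcs G \<Longrightarrow> tail G a \<noteq> s \<Longrightarrow> head G a \<noteq> s \<Longrightarrow> tail G a \<rightarrow>\<^bsub>X\<^esub> head G a"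
  by (force simp: arcs_ends_def arc_to_ends_def del_vert_simps)

lemma X_arcE:
  assumes "u \<rightarrow>\<^bsub>X\<^esub> v"
  obtains a where "a \<in> out_arcs G u" "head G a = v" "u \<in> V" "v \<in> V"
  using assms by (auto simp: arcs_ends_def arc_to_ends_def del_vert_simps)

lemma out_closed_cl: "out_closed (cl G s S)"
  unfolding out_closed_def
proof (intro conjI ballI impI)
  fix a assume a: "a \<in> arcs G" "tail G a \<in> cl G s S"
  then obtain w where w: "w \<in> S" "w \<rightarrow>\<^sup>*\<^bsub>X\<^esub> tail G a" "tail G a \<noteq> s" by (auto simp: cl_def)
  show "head G a \<in> cl G s S \<union> {s}"
  proof (cases "head G a = s")
    case False
    then have "w \<rightarrow>\<^sup>*\<^bsub>X\<^esub> head G a" using X.reachable_adj_trans w arc_in_X[OF a(1)] by blast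
    then show ?thesis using w(1) a(1) False by (auto simp: cl_def)
  qed simp
qed (auto simp: cl_def)

text \<open>Induction along the path, passing from tail to head by
  \<open>divisor_on_grain_iff_spread\<close>.\<close>

lemma divisor_on_grain_reachable:
  assumes T: "out_closed T" and e: "stab (\<lambda>v. e v + e v) = e" "supp e \<subseteq> T"
    and "u \<rightarrow>\<^sup>*\<^bsub>X\<^esub> v" "divisor_on T e (grain u)"
  shows "divisor_on T e (grain v)"
  using assms(4)
proof (induction rule: X.reachable_induct)
  case base
  show ?case by fact
next
  case (step x y)
  from step(2) obtain a where a: "a \<in> out_arcs G x" "head G a = y" "y \<in> V" by (rule X_arcE)
  have "x \<in> T" using step(3) by (simp add: divisor_on_def)
  then show ?case using divisor_on_grain_iff_spread[OF T e] step(3) a by auto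
qed

lemma subset_cl: "S \<subseteq> V \<Longrightarrow> S \<subseteq> cl G s S"
  by (auto simp: cl_def verts_del_vert intro!: bexI X.reachable_refl)

text \<open>The idempotent divides itself, hence so do the grains on its support, and from there the
  property travels along paths.\<close>

lemma divisor_on_cl:
  assumes T: "out_closed T" and e: "stab (\<lambda>v. e v + e v) = e" "supp e \<subseteq> T"
    and "v \<in> cl G s (supp e)"
  shows "divisor_on T e (grain v)"
proof -
  obtain w where "w \<in> supp e" "w \<rightarrow>\<^sup>*\<^bsub>X\<^esub> v" using assms(4) by (auto simp: cl_def)
  then show ?thesis
    using divisor_on_grain_reachable[OF T e] divisor_on_iff_grains[OF T e]
      divisor_on_self[OF e] by blast
qed

section \<open>Grains trapped in strongly connected components\<close>

text \<open>A toppling inside \<open>Z\<close> puts a grain back into \<open>Z\<close>, and a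
  toppling outside takes none away, so \<open>Z\<close> can never be emptied.\<close>

lemma trapped_grain:
  assumes "(topples_to G s)\<^sup>*\<^sup>* c c'" "s \<notin> Z"
    and "\<And>w. w \<in> Z \<Longrightarrow> \<exists>a\<in>out_arcs G w. head G a \<in> Z"
    and "Z \<inter> supp c \<noteq> {}"
  shows "Z \<inter> supp c' \<noteq> {}"
  using assms(1)
proof induction
  case (step x y)
  then obtain v where v: "v \<in> V" "y = topple G s v x" by (auto simp: topples_to_def)
  show ?case
  proof (cases "v \<in> Z")
    case True
    then obtain a where a: "a \<in> out_arcs G v" "head G a \<in> Z" using assms(3) by blast
    then have "card {b \<in> out_arcs G v. head G b = head G a} > 0"
      by (auto simp: card_gt_0_iff)
    then have "head G a \<in> supp y" using v a assms(2) by (auto simp: supp_def topple_def)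
    then show ?thesis using a by auto
  next
    case False
    obtain w where "w \<in> Z \<inter> supp x" using step by blast
    then have "w \<in> supp y" using v False assms(2) by (auto simp: supp_def topple_def)
    then show ?thesis using \<open>w \<in> Z \<inter> supp x\<close> by auto
  qed
qed (fact assms(4))

text \<open>The component of \<open>u\<close> is a trap for \<open>trapped_grain\<close>: it is
  occupied in \<open>grain u + y\<close>, hence also in the stabilization \<open>e\<close>.\<close>

lemma divisor_meets_scc:
  assumes u: "u \<rightarrow>\<^sup>+\<^bsub>X\<^esub> u" and "divisor_on T e (grain u)"
  shows "X.scc_of u \<inter> supp e \<noteq> {}"
proof -
  obtain y where y: "stab (\<lambda>v. grain u v + y v) = e"
    using assms(2) by (auto simp: divisor_on_def)
  have uX: "u \<in> verts X" using u by (metis X.reachable1_in_verts(1))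
  show ?thesis
  proof (rule trapped_grain[where c = "\<lambda>v. grain u v + y v"])
    show "(topples_to G s)\<^sup>*\<^sup>* (\<lambda>v. grain u v + y v) e" using topples_to_stab y by metis
    show "s \<notin> X.scc_of u"
      using X.reachable_in_verts by (fastforce simp: X.scc_of_def verts_del_vert)
    have "u \<in> X.scc_of u" using uX by (rule X.in_scc_of_self)
    then show "X.scc_of u \<inter> supp (\<lambda>v. grain u v + y v) \<noteq> {}"
      by (auto simp: supp_add)
    fix w assume "w \<in> X.scc_of u"
    then have w: "u \<rightarrow>\<^sup>*\<^bsub>X\<^esub> w" "w \<rightarrow>\<^sup>*\<^bsub>X\<^esub> u" by (auto simp: X.scc_of_def)
    have "w \<rightarrow>\<^sup>+\<^bsub>X\<^esub> u" using w(2) u by (rule X.reachable_reachable1_trans)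
    \<comment> \<open>The first arc of a nontrivial path from \<open>w\<close> back to
      \<open>u\<close> stays in the component, which is the arc required of a trap.\<close>
    then obtain x where x: "w \<rightarrow>\<^bsub>X\<^esub> x" "x \<rightarrow>\<^sup>*\<^bsub>X\<^esub> u"
      by (metis X.reachable1_reachable X.reachable_refl tranclD rtrancl_eq_or_trancl X.reachable1_in_verts(2) \<open>u \<in> verts X\<close>)
    then have "x \<in> X.scc_of u" using w X.reachable_adj_trans by (auto simp: X.scc_of_def)
    with x(1) show "\<exists>a\<in>out_arcs G w. head G a \<in> X.scc_of u" by (metis X_arcE)
  qed
qed

section \<open>Cyclic components and \<open>A_set\<close> in terms of reachability\<close>

text \<open>A closed walk through \<open>v\<close> can be rotated so as to start and end at
  \<open>v\<close>.\<close>

lemma acyclic_vertex_iff: "acyclic_vertex G s v \<longleftrightarrow> \<not> v \<rightarrow>\<^sup>+\<^bsub>X\<^esub> v"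
proof -
  have "v \<rightarrow>\<^sup>+\<^bsub>X\<^esub> v" if "cycle_on G s u p" "v \<in> set (X.awalk_verts u p)" for u p
  proof -
    have p: "X.awalk u p u" "p \<noteq> []" using that by (auto simp: cycle_on_def)
    then have "u \<rightarrow>\<^sup>+\<^bsub>X\<^esub> u" by (auto simp: X.reachable1_awalk)
    then show ?thesis
      using X.awalk_verts_reachable_from[OF p(1) that(2)] X.awalk_verts_reachable_to[OF p(1) that(2)]
      by (meson X.reachable1_reachable_trans X.reachable_reachable1_trans)
  qed
  moreover have "\<exists>u p. cycle_on G s u p \<and> v \<in> set (X.awalk_verts u p)" if v: "v \<rightarrow>\<^sup>+\<^bsub>X\<^esub> v"
  proof -
    obtain p where p: "X.awalk v p v" "p \<noteq> []" using v by (auto simp: X.reachable1_awalk)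
    then have "cycle_on G s v p" by (simp add: cycle_on_def Suc_le_eq)
    moreover have "v \<in> set (X.awalk_verts v p)" using X.awhd_of_awalk[OF p(1)] by (cases p) auto
    ultimately show ?thesis by blast
  qed
  ultimately show ?thesis unfolding acyclic_vertex_def by blast
qed

lemma cyclic_component_iff:
  "cyclic_component G s C \<longleftrightarrow> (\<exists>u. u \<rightarrow>\<^sup>+\<^bsub>X\<^esub> u \<and> C = X.scc_of u)"
proof
  assume "cyclic_component G s C"
  then obtain u p where C: "C \<in> X.sccs_verts" and p: "cycle_on G s u p" "set (X.awalk_verts u p) \<subseteq> C"
    by (auto simp: cyclic_component_def)
  have w: "X.awalk u p u" "p \<noteq> []" using p by (auto simp: cycle_on_def)
  then have u: "u \<rightarrow>\<^sup>+\<^bsub>X\<^esub> u" by (auto simp: X.reachable1_awalk)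
  have "u \<in> C" using p(2) X.awhd_of_awalk[OF w(1)] by (cases p) auto
  then have "C = X.scc_of u" using C by (auto simp: X.sccs_verts_def X.scc_of_def)
  with u show "\<exists>u. u \<rightarrow>\<^sup>+\<^bsub>X\<^esub> u \<and> C = X.scc_of u" by blast
next
  assume "\<exists>u. u \<rightarrow>\<^sup>+\<^bsub>X\<^esub> u \<and> C = X.scc_of u"
  then obtain u where u: "u \<rightarrow>\<^sup>+\<^bsub>X\<^esub> u" and C: "C = X.scc_of u" by blast
  obtain p where p: "X.awalk u p u" "p \<noteq> []" using u by (auto simp: X.reachable1_awalk)
  then have "cycle_on G s u p" by (simp add: cycle_on_def Suc_le_eq)
  moreover have "set (X.awalk_verts u p) \<subseteq> C"
    using X.awalk_verts_reachable_from[OF p(1)] X.awalk_verts_reachable_to[OF p(1)]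
    by (auto simp: C X.scc_of_def)
  moreover have "C \<in> X.sccs_verts"
    unfolding C using u by (metis X.scc_of_in_sccs_verts X.reachable1_in_verts(1))
  ultimately show "cyclic_component G s C" by (auto simp: cyclic_component_def)
qed

lemma A_set_iff:
  "v \<in> A_set G s e \<longleftrightarrow> v \<in> V \<and> \<not> v \<rightarrow>\<^sup>+\<^bsub>X\<^esub> v \<and> v \<notin> cl G s (supp e) \<and>
    (\<forall>u. u \<rightarrow>\<^sup>+\<^bsub>X\<^esub> u \<and> v \<rightarrow>\<^sup>*\<^bsub>X\<^esub> u \<longrightarrow> X.scc_of u \<inter> supp e \<noteq> {})"
proof -
  have "(\<exists>w\<in>X.scc_of u. v \<rightarrow>\<^sup>*\<^bsub>X\<^esub> w) \<longleftrightarrow> v \<rightarrow>\<^sup>*\<^bsub>X\<^esub> u" for u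
    by (auto simp: X.scc_of_def intro: X.reachable_trans X.reachable_refl
        dest: X.reachable_in_verts)
  moreover have "(\<forall>C. cyclic_component G s C \<and> P C \<longrightarrow> Q C) \<longleftrightarrow>
      (\<forall>u. u \<rightarrow>\<^sup>+\<^bsub>X\<^esub> u \<and> P (X.scc_of u) \<longrightarrow> Q (X.scc_of u))" for P Q
    unfolding cyclic_component_iff by blast
  ultimately show ?thesis
    unfolding A_set_def acyclic_vertex_iff by simp
qed

text \<open>The condition on cyclic components passes from \<open>v\<close> to \<open>u\<close>. If
  \<open>u\<close> were on a cycle, its own component would meet \<open>supp e\<close>, which would
  put \<open>u\<close> into the closure.\<close>

lemma X_adj_A_set:
  assumes "v \<in> A_set G s e" "v \<rightarrow>\<^bsub>X\<^esub> u"
  shows "u \<in> A_set G s e \<union> cl G s (supp e)"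
proof (cases "u \<in> cl G s (supp e)")
  case False
  have u: "u \<in> V" using assms(2) by (rule X_arcE)
  have reach: "X.scc_of x \<inter> supp e \<noteq> {}" if "x \<rightarrow>\<^sup>+\<^bsub>X\<^esub> x" "u \<rightarrow>\<^sup>*\<^bsub>X\<^esub> x" for x
    using assms that X.adj_reachable_trans[OF assms(2) that(2)] by (auto simp: A_set_iff)
  have "\<not> u \<rightarrow>\<^sup>+\<^bsub>X\<^esub> u"
  proof
    assume "u \<rightarrow>\<^sup>+\<^bsub>X\<^esub> u"
    then have "X.scc_of u \<inter> supp e \<noteq> {}" using reach by blast
    then show False using False u by (auto simp: X.scc_of_def cl_def)
  qed
  then show ?thesis using u False reach by (auto simp: A_set_iff)
qed simp

text \<open>All non-sink heads of arcs leaving a vertex of \<open>A_set\<close> lie in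
  \<open>A_set\<close> or in the closure of \<open>supp e\<close>. As \<open>A_set\<close> is
  acyclic, induction from heads to tails applies.\<close>

lemma divisor_on_A_set:
  assumes e: "stab (\<lambda>v. e v + e v) = e" "supp e \<subseteq> V" and "v \<in> A_set G s e"
  shows "divisor_on V e (grain v)"
proof -
  \<comment> \<open>The head comes first, so well-founded induction on \<open>r\<close> supplies the
    claim for out-neighbours. A cycle of \<open>r\<close> would be a cycle of \<open>X\<close>
    through a vertex of \<open>A_set\<close>.\<close>
  define r where "r = {(u, v). v \<rightarrow>\<^bsub>X\<^esub> u \<and> v \<in> A_set G s e}"
  have "v \<rightarrow>\<^sup>+\<^bsub>X\<^esub> u \<and> v \<in> A_set G s e" if "(u, v) \<in> r\<^sup>+" for u v
    using that
  proof induction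
    case (step x y)
    then show ?case using trancl_into_trancl2[of y x "arcs_ends X" u] by (simp add: r_def)
  qed (auto simp: r_def)
  then have "acyclic r" by (auto simp: acyclic_def A_set_iff)
  moreover have "r \<subseteq> V \<times> V" by (auto simp: r_def elim: X_arcE)
  then have "finite r" by (rule finite_subset) simp
  ultimately have "wf r" by (rule finite_acyclic_wf[rotated])
  then show ?thesis using assms(3)
  proof (induction v rule: wf_induct_rule)
    case (less v)
    have v: "v \<in> V" using less.prems by (simp add: A_set_iff)
    have "divisor_on V e (grain (head G a))" if a: "a \<in> out_arcs G v" "head G a \<noteq> s" for a
    proof -
      have "v \<rightarrow>\<^bsub>X\<^esub> head G a" using arc_in_X[of a] a v by auto
      then show ?thesis
        using less X_adj_A_set[OF less.prems] divisor_on_cl[OF out_closed_V e] by (auto simp: r_def)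
    qed
    then show ?case using divisor_on_grain_iff_spread[OF out_closed_V e v] by blast
  qed
qed

text \<open>For the new direction, a grain dividing \<open>e\<close> passes this on to all vertices
  it reaches, so by \<open>divisor_meets_scc\<close> each reachable cyclic component meets
  \<open>supp e\<close>. Were \<open>v\<close> itself on a cycle, it would then be reachable from
  \<open>supp e\<close>.\<close>

lemma divisor_on_V_iff:
  assumes e: "stab (\<lambda>v. e v + e v) = e" "supp e \<subseteq> V"
  shows "divisor_on V e c \<longleftrightarrow> supp c \<subseteq> cl G s (supp e) \<union> A_set G s e"
proof -
  have "v \<in> cl G s (supp e) \<union> A_set G s e" if v: "divisor_on V e (grain v)" for v
  proof (cases "v \<in> cl G s (supp e)")
    case False
    have vV: "v \<in> V" using v by (simp add: divisor_on_def)
    have meets: "X.scc_of u \<inter> supp e \<noteq> {}" if "u \<rightarrow>\<^sup>+\<^bsub>X\<^esub> u" "v \<rightarrow>\<^sup>*\<^bsub>X\<^esub> u" for u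
      using divisor_meets_scc[OF that(1)] divisor_on_grain_reachable[OF out_closed_V e that(2) v] by blast
    have "\<not> v \<rightarrow>\<^sup>+\<^bsub>X\<^esub> v"
    proof
      assume "v \<rightarrow>\<^sup>+\<^bsub>X\<^esub> v"
      then have "X.scc_of v \<inter> supp e \<noteq> {}" using meets by blast
      then show False using False vV by (auto simp: X.scc_of_def cl_def)
    qed
    then show ?thesis using vV False meets by (auto simp: A_set_iff)
  qed simp
  then show ?thesis
    using divisor_on_iff_grains[OF out_closed_V e] divisor_on_cl[OF out_closed_V e]
      divisor_on_A_set[OF e] by blast
qed

subsection \<open>The maximal subgroup\<close>

text \<open>The closure loses no out-arcs, so out-degrees and topplings agree there, and grains
  starting in it stay in it until they reach the sink. Outside it every vertex is empty and thus
  stable.\<close>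

lemma
  shows carrier_iota: "c \<in> carrier (sandpile_monoid (iota G s S) s) \<longleftrightarrow>
      c \<in> carrier (sandpile_monoid G s) \<and> supp c \<subseteq> cl G s S"
    and mult_iota: "supp a \<subseteq> cl G s S \<Longrightarrow> supp b \<subseteq> cl G s S \<Longrightarrow>
      a \<otimes>\<^bsub>sandpile_monoid (iota G s S) s\<^esub> b = a \<otimes>\<^bsub>sandpile_monoid G s\<^esub> b"
proof -
  let ?H = "iota G s S" and ?T = "cl G s S"
  have TV: "?T \<subseteq> V" by (auto simp: cl_def)
  have VH: "verts ?H - {s} = ?T" using TV by (auto simp: iota_def)
  have out: "out_arcs ?H v = out_arcs G v" if "v \<in> ?T" for v
    using that by (auto simp: iota_def out_arcs_def)
  have deg: "out_degree ?H v = out_degree G v" if "v \<in> ?T" for v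
    using out[OF that] by (simp add: out_degree_def)
  have head_iota: "head ?H = head G" by (simp add: iota_def)
  have top: "topple ?H s v c = topple G s v c" if "v \<in> ?T" for v c
    unfolding topple_def out[OF that] deg[OF that] head_iota ..
  have st: "stable ?H s c \<longleftrightarrow> stable G s c" if "supp c \<subseteq> ?T" for c
  proof -
    have "c v < out_degree G v" if "v \<in> V" "v \<notin> ?T" for v
      using that \<open>supp c \<subseteq> ?T\<close> out_degree_pos[of v] by (fastforce simp: supp_def subset_iff)
    then show ?thesis unfolding stable_def VH using deg TV by auto
  qed
  have step: "topples_to ?H s c c' \<longleftrightarrow> topples_to G s c c'" if "supp c \<subseteq> ?T" for c c'
  proof -
    have "v \<in> ?T" if "v \<in> V" "out_degree G v \<le> c v" for v
      using that \<open>supp c \<subseteq> ?T\<close> out_degree_pos[of v] by (fastforce simp: supp_def subset_iff)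
    then show ?thesis unfolding topples_to_def VH using deg top TV by auto
  qed
  have steps: "supp c' \<subseteq> ?T \<and> (topples_to G s)\<^sup>*\<^sup>* c c'"
    if "(topples_to ?H s)\<^sup>*\<^sup>* c c'" "supp c \<subseteq> ?T" for c c'
    using that(1)
    by induction (use that(2) step supp_topple[OF _ out_closed_cl] in \<open>auto intro: rtranclp.rtrancl_into_rtrancl\<close>)
  have steps': "supp c' \<subseteq> ?T \<and> (topples_to ?H s)\<^sup>*\<^sup>* c c'"
    if "(topples_to G s)\<^sup>*\<^sup>* c c'" "supp c \<subseteq> ?T" for c c'
    using that(1)
    by induction (use that(2) step supp_topple[OF _ out_closed_cl] in \<open>auto intro: rtranclp.rtrancl_into_rtrancl\<close>)
  have "stabilization ?H s c = stab c" if "supp c \<subseteq> ?T" for c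
    unfolding stabilization_def
    using steps[OF _ that] steps'[OF _ that] st by metis
  then show "supp a \<subseteq> ?T \<Longrightarrow> supp b \<subseteq> ?T \<Longrightarrow>
      a \<otimes>\<^bsub>sandpile_monoid ?H s\<^esub> b = a \<otimes>\<^bsub>sandpile_monoid G s\<^esub> b"
    by (simp add: sandpile_monoid_def supp_add)
  have "c \<in> configs ?H s \<longleftrightarrow> supp c \<subseteq> ?T"
    unfolding configs_def VH by (auto simp: supp_def Suc_le_eq)
  then show "c \<in> carrier (sandpile_monoid ?H s) \<longleftrightarrow>
      c \<in> carrier (sandpile_monoid G s) \<and> supp c \<subseteq> ?T"
    using st TV by (auto simp: sandpile_monoid_def configs_iff_supp)
qed

text \<open>On the closure every configuration divides \<open>e\<close>, so the multiples of
  \<open>e\<close> form the minimal ideal of this monoid, and its elements are the recurrent ones;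
  they are recognized by absorbing \<open>e\<close>.\<close>

lemma recurrent_iota_iff:
  assumes e: "stab (\<lambda>v. e v + e v) = e" "supp e \<subseteq> V"
  shows "recurrent (sandpile_monoid (iota G s (supp e)) s) g \<longleftrightarrow>
    g \<in> carrier (sandpile_monoid G s) \<and> supp g \<subseteq> cl G s (supp e) \<and> stab (\<lambda>v. g v + e v) = g"
    (is "recurrent ?N g \<longleftrightarrow> g \<in> carrier ?M \<and> supp g \<subseteq> ?T \<and> _")
proof
  note iota = carrier_iota mult_iota
  have eT: "supp e \<subseteq> ?T" using e(2) by (rule subset_cl)
  have T: "out_closed ?T" by (rule out_closed_cl)
  have TV: "?T \<subseteq> V" by (auto simp: cl_def)
  {
    assume g: "recurrent ?N g"
    have "e \<in> carrier ?N" using e eT stable_stab[of "\<lambda>v. e v + e v"] by (simp add: iota in_carrier)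
    with g obtain x where x: "x \<in> carrier ?N" "e \<otimes>\<^bsub>?N\<^esub> x = g"
      by (auto simp: recurrent_def accessible_def)
    then have gx: "g = stab (\<lambda>v. e v + x v)" and xV: "supp x \<subseteq> V"
      using iota eT TV by (auto simp: mult_eq)
    have "stab (\<lambda>v. g v + e v) = stab (\<lambda>v. (e v + x v) + e v)"
      unfolding gx by (rule stab_add_left) fact
    also have "\<dots> = stab (\<lambda>v. (e v + e v) + x v)" by (simp add: algebra_simps)
    also have "\<dots> = stab (\<lambda>v. stab (\<lambda>v. e v + e v) v + x v)"
      by (rule stab_add_left[symmetric]) fact
    finally have "stab (\<lambda>v. g v + e v) = g" using e gx by simp
    with g show "g \<in> carrier ?M \<and> supp g \<subseteq> ?T \<and> stab (\<lambda>v. g v + e v) = g"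
      by (simp add: recurrent_def iota)
  next
    assume g: "g \<in> carrier ?M \<and> supp g \<subseteq> ?T \<and> stab (\<lambda>v. g v + e v) = g"
    have "accessible ?N g b" if "b \<in> carrier ?N" for b
    proof -
      have b: "supp b \<subseteq> ?T" using that iota by simp
      then have "divisor_on ?T e b"
        using divisor_on_iff_grains[OF T e(1) eT] divisor_on_cl[OF T e(1) eT] by blast
      then obtain y where y: "supp y \<subseteq> ?T" "stab (\<lambda>v. b v + y v) = e"
        by (auto simp: divisor_on_def)
      \<comment> \<open>With \<open>y\<close> the cofactor of \<open>b\<close>, this gives
        \<open>b \<oplus> x = e \<oplus> g = g\<close>.\<close>
      define x where "x = stab (\<lambda>v. y v + g v)"
      have x: "supp x \<subseteq> ?T" "x \<in> carrier ?M"
        unfolding x_def using y(1) g TV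
        by (intro supp_stab[OF T] stab_in_carrier; auto simp: supp_add)+
      have gV: "supp g \<subseteq> V" and bV: "supp b \<subseteq> V" using g b TV by auto
      have "b \<otimes>\<^bsub>?N\<^esub> x = stab (\<lambda>v. b v + stab (\<lambda>v. y v + g v) v)"
        using iota b x by (simp add: mult_eq x_def)
      also have "\<dots> = stab (\<lambda>v. (b v + y v) + g v)"
        using stab_add_right[OF bV] by (simp add: add.assoc)
      also have "\<dots> = stab (\<lambda>v. e v + g v)" using stab_add_left[OF gV, of "\<lambda>v. b v + y v"] y by simp
      also have "\<dots> = g" using g by (simp add: add.commute)
      finally show ?thesis using x iota by (auto simp: accessible_def)
    qed
    then show "recurrent ?N g" using g iota by (simp add: recurrent_def)
  }
qed

text \<open>This joins \<open>maximal_subgroup_eq\<close> to the description of divisors by support;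
  stabilizing a cofactor makes it an element of the monoid.\<close>

lemma maximal_subgroup_iff_supp:
  assumes e: "e \<in> carrier (sandpile_monoid G s)" "stab (\<lambda>v. e v + e v) = e"
  shows "a \<in> maximal_subgroup (sandpile_monoid G s) e \<longleftrightarrow>
    a \<in> carrier (sandpile_monoid G s) \<and> stab (\<lambda>v. a v + e v) = a \<and>
    supp a \<subseteq> cl G s (supp e) \<union> A_set G s e"
proof -
  have eV: "supp e \<subseteq> V" using e(1) by (simp add: in_carrier)
  have "(\<exists>b\<in>carrier (sandpile_monoid G s). stab (\<lambda>v. a v + b v) = e) \<longleftrightarrow> divisor_on V e a"
    if a: "a \<in> carrier (sandpile_monoid G s)"
  proof -
    have aV: "supp a \<subseteq> V" using a by (simp add: in_carrier)
    show ?thesis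
    proof
      assume "\<exists>b\<in>carrier (sandpile_monoid G s). stab (\<lambda>v. a v + b v) = e"
      then obtain b where "supp b \<subseteq> V" "stab (\<lambda>v. a v + b v) = e" by (auto simp: in_carrier)
      then show "divisor_on V e a" unfolding divisor_on_def using aV by (intro conjI exI[of _ b])
    next
      assume "divisor_on V e a"
      then obtain y where "supp y \<subseteq> V" "stab (\<lambda>v. a v + y v) = e" by (auto simp: divisor_on_def)
      then show "\<exists>b\<in>carrier (sandpile_monoid G s). stab (\<lambda>v. a v + b v) = e"
        using stab_add_right[OF aV, of y] stab_in_carrier[of y] by (intro bexI[of _ "stab y"]) simp_all
    qed
  qed
  then show ?thesis
    using maximal_subgroup_eq[OF comm_monoid_sandpile e(1)] e(2) divisor_on_V_iff[OF e(2) eV]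
    by (auto simp: mult_eq)
qed

text \<open>A sum \<open>g \<oplus> j\<close> absorbs \<open>e\<close> because \<open>g\<close>
  does, and its support is right because it divides \<open>e\<close>. Conversely an element of the
  group is cut into its restrictions to the closure and to \<open>A_set\<close>; only recurrence of
  the first needs an argument.\<close>

lemma maximal_subgroup_sandpile:
  assumes e: "e \<in> carrier (sandpile_monoid G s)" "stab (\<lambda>v. e v + e v) = e"
  shows "maximal_subgroup (sandpile_monoid G s) e =
    {g \<otimes>\<^bsub>sandpile_monoid G s\<^esub> j | g j.
       g \<in> carrier (sandpile_monoid G s) \<and> j \<in> carrier (sandpile_monoid G s) \<and>
       recurrent (sandpile_monoid (iota G s (supp e)) s) g \<and> supp j \<subseteq> A_set G s e}"
    (is "?G = ?R")
proof (intro Set.set_eqI iffI)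
  let ?M = "sandpile_monoid G s" and ?T = "cl G s (supp e)" and ?A = "A_set G s e"
  have eV: "supp e \<subseteq> V" using e(1) by (simp add: in_carrier)
  have eT: "supp e \<subseteq> ?T" using eV by (rule subset_cl)
  have TV: "?T \<subseteq> V" and AV: "?A \<subseteq> V" by (auto simp: cl_def A_set_def)
  note rec = recurrent_iota_iff[OF e(2) eV]
  {
    fix a assume "a \<in> ?R"
    then obtain g j where a: "a = stab (\<lambda>v. g v + j v)" and g: "supp g \<subseteq> ?T" "stab (\<lambda>v. g v + e v) = g"
      and j: "supp j \<subseteq> ?A" using rec by (auto simp: mult_eq)
    have V: "supp (\<lambda>v. g v + j v) \<subseteq> V" "supp j \<subseteq> V" using g j TV AV by (auto simp: supp_add)
    have "divisor_on V e (\<lambda>v. g v + j v)"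
      using divisor_on_V_iff[OF e(2) eV] g j by (auto simp: supp_add)
    then have "divisor_on V e a" unfolding a by (rule divisor_on_stab[OF out_closed_V])
    then have "supp a \<subseteq> ?T \<union> ?A" using divisor_on_V_iff[OF e(2) eV] by blast
    moreover have "stab (\<lambda>v. a v + e v) = stab (\<lambda>v. (g v + e v) + j v)"
      unfolding a using stab_add_left[OF eV, of "\<lambda>v. g v + j v"] by (simp add: algebra_simps)
    then have "stab (\<lambda>v. a v + e v) = a"
      using stab_add_left[OF V(2), of "\<lambda>v. g v + e v"] g a by simp
    ultimately show "a \<in> ?G"
      using maximal_subgroup_iff_supp[OF e] stab_in_carrier[OF V(1)] a by simp
  next
    fix a assume "a \<in> ?G"
    then have a: "a \<in> carrier ?M" "stab (\<lambda>v. a v + e v) = a" "supp a \<subseteq> ?T \<union> ?A"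
      using maximal_subgroup_iff_supp[OF e] by auto
    define g where "g v = (if v \<in> ?T then a v else 0)" for v
    define j where "j v = (if v \<in> ?T then 0 else a v)" for v
    have sum: "(\<lambda>v. g v + j v) = a" by (auto simp: g_def j_def)
    have supps: "supp g \<subseteq> ?T" "supp j \<subseteq> ?A" using a(3) by (auto simp: g_def j_def supp_def subset_iff)
    have "stable G s g" "stable G s j"
      using a(1) out_degree_pos by (auto simp: in_carrier stable_def g_def j_def)
    then have carr: "g \<in> carrier ?M" "j \<in> carrier ?M"
      using supps TV AV by (auto simp: in_carrier)
    \<comment> \<open>Here \<open>h = g \<oplus> e\<close> lives on the closure and \<open>j\<close>
      off it, so \<open>h + j\<close> is stable. It stabilizes to \<open>a \<oplus> e = a\<close>,
      hence \<open>h + j = a = g + j\<close>, and cancelling \<open>j\<close> shows that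
      \<open>g\<close> absorbs \<open>e\<close>.\<close>
    define h where "h = stab (\<lambda>v. g v + e v)"
    have hT: "supp h \<subseteq> ?T"
      unfolding h_def using supps eT by (intro supp_stab out_closed_cl) (auto simp: supp_add)
    have "stable G s (\<lambda>v. h v + j v)"
      unfolding stable_def
    proof
      fix v assume "v \<in> V"
      have "h v = 0 \<or> j v = 0" using hT by (auto simp: supp_def j_def subset_iff Suc_le_eq)
      moreover have "h v < out_degree G v" "j v < out_degree G v"
        using \<open>v \<in> V\<close> stable_stab \<open>stable G s j\<close> by (auto simp: h_def stable_def)
      ultimately show "h v + j v < out_degree G v" by auto
    qed
    moreover have "stab (\<lambda>v. h v + j v) = a"
    proof -
      have "supp j \<subseteq> V" using supps AV by auto
      then have "stab (\<lambda>v. h v + j v) = stab (\<lambda>v. (g v + e v) + j v)"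
        unfolding h_def by (rule stab_add_left)
      also have "(\<lambda>v. (g v + e v) + j v) = (\<lambda>v. a v + e v)"
        using sum by (auto simp: fun_eq_iff)
      finally show ?thesis using a(2) by simp
    qed
    ultimately have ha: "(\<lambda>v. h v + j v) = a" using stab_stable by simp
    have "h = g"
    proof
      fix v show "h v = g v" using fun_cong[OF ha, of v] fun_cong[OF sum, of v] by linarith
    qed
    then have "recurrent (sandpile_monoid (iota G s (supp e)) s) g"
      using rec carr supps by (simp add: h_def)
    moreover have "a = g \<otimes>\<^bsub>?M\<^esub> j"
      using sum a(1) stab_stable by (simp add: mult_eq in_carrier)
    ultimately show "a \<in> ?R" using carr supps by blast
  }
qed

end

theorem theorem3p6:
  fixes G :: "('a, 'b) pre_digraph" and s :: 'a and e :: "'a \<Rightarrow> nat"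
  assumes "sandpile_graph G s"
    and "out_arcs G s = {}"
    and "e \<in> carrier (sandpile_monoid G s)"
    and "e \<otimes>\<^bsub>sandpile_monoid G s\<^esub> e = e"
    and "e \<noteq> \<one>\<^bsub>sandpile_monoid G s\<^esub>"
  shows "maximal_subgroup (sandpile_monoid G s) e =
    {g \<otimes>\<^bsub>sandpile_monoid G s\<^esub> j | g j.
       g \<in> carrier (sandpile_monoid G s) \<and> j \<in> carrier (sandpile_monoid G s) \<and>
       recurrent (sandpile_monoid (iota G s (supp e)) s) g \<and> supp j \<subseteq> A_set G s e}"
proof -
  interpret sandpile_graph G s by fact
  show ?thesis
    using maximal_subgroup_sandpile[OF assms(3)] assms(4) by (simp add: mult_eq)
qed

end
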